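(* Let $\mathbf{D}$ be the unit disk and $\mathbf{U}=\{z\in\mathbb{C}:\Im z>0\}$ the upper half-plane. Let $f=h+\overline{g}$ be a harmonic diffeomorphism of $\mathbf{D}$ onto $\mathbf{U}$, where $h,g$ are holomorphic on $\mathbf{D}$, with $f(0)=i$. Then for every $z\in\mathbf{D}$, $$|Df(z)|=|h'(z)|+|g'(z)|\ge \frac{1}{2}\,\mathrm{dist}(f(0),\partial\mathbf{U}),$$ and this inequality is sharp.
   Context: A harmonic map $f$ on a simply connected domain decomposes as $f=h+\overline{g}$ with $h,g$ holomorphic; $|Df(z)|$ denotes the operator norm of the differential, which equals $|h'(z)|+|g'(z)|$. Here $\partial\mathbf{U}=\mathbb{R}$, so $\mathrm{dist}(f(0),\partial\mathbf{U})=1$. *)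

theory Defs
  imports "HOL-Analysis.Analysis"
begin

text \<open>A (real) diffeomorphism of S onto T: a homeomorphism which is
  real-differentiable on S and whose inverse is real-differentiable on T.
  (Differentiability here is Frechet differentiability of maps between the
  real normed spaces underlying the complex plane.)\<close>
definition diffeo_between :: "(complex \<Rightarrow> complex) \<Rightarrow> complex set \<Rightarrow> complex set \<Rightarrow> bool" where
  "diffeo_between f S T \<longleftrightarrow>
     (\<exists>f'. homeomorphism S T f f' \<and> f differentiable_on S \<and> f' differentiable_on T)"

definition upper_half_plane :: "complex set" where
  "upper_half_plane = {z. 0 < Im z}"

definition admissible_pair :: "(complex \<Rightarrow> complex) \<Rightarrow> (complex \<Rightarrow> complex) \<Rightarrow> bool" where
  "admissible_pair h g \<longleftrightarrow>
     h holomorphic_on ball 0 1 \<and> g holomorphic_on ball 0 1 \<and>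
     diffeo_between (\<lambda>z. h z + cnj (g z)) (ball 0 1) upper_half_plane \<and>
     h 0 + cnj (g 0) = \<i>"

end

theory Submission
  imports Defs "HOL-Complex_Analysis.Complex_Analysis"
begin

text \<open>
  The shear \<open>F = h - g\<close> differs from \<open>f = h + cnj g\<close> by the real function \<open>2 Re g\<close>, so
  \<open>Im F = Im f > 0\<close>. It is injective: \<open>F \<circ> f\<^sup>-\<^sup>1\<close> preserves horizontal lines and, \<open>Df\<close> being
  invertible, has nonzero derivative along them, so Rolle's theorem applies. If \<open>F\<close> is onto
  the upper half-plane, then it is a Moebius map by the Schwarz lemma, with
  \<open>|F'(z)| = 2 / |1 - \<alpha> z|\<^sup>2 \<ge> 1/2\<close>, and \<open>|h'| + |g'| \<ge> |F'|\<close>.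

  Were \<open>\<Omega> = F(D)\<close> a proper subset, it would omit a horizontal ray, because it meets every
  horizontal line in a nonempty interval. On \<open>\<Omega>\<close>, \<open>f \<circ> F\<^sup>-\<^sup>1 = Re G + i Im\<close> with
  \<open>G = (h + g) \<circ> F\<^sup>-\<^sup>1\<close>. Near the tip of the ray, \<open>Re G\<close> tends to infinity with a fixed sign at all
  boundary points of \<open>\<Omega>\<close>. Hence \<open>exp (\<plusminus>G)\<close>, extended by 0, is continuous, holomorphic where it
  is nonzero, and zero on the ray, which is impossible.
\<close>

section \<open>Vanishing across a slit by the maximum principle\<close>

text \<open>The maximum modulus principle is applied on the open set where \<open>P\<close> is
  nonzero. Its frontier points are either zeros of \<open>P\<close> inside the ball or points of the
  sphere, so \<open>P\<close> is 0 on the whole frontier.\<close>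

lemma vanishes_if_boundary_zero:
  fixes P :: "complex \<Rightarrow> complex"
  assumes cont: "continuous_on (cball c \<rho>) P"
    and holo: "P holomorphic_on {z \<in> ball c \<rho>. P z \<noteq> 0}"
    and sph: "\<And>z. z \<in> sphere c \<rho> \<Longrightarrow> P z = 0"
    and z: "z \<in> cball c \<rho>"
  shows "P z = 0"
proof (rule ccontr)
  assume nz: "P z \<noteq> 0"
  define S where "S = {z \<in> ball c \<rho>. P z \<noteq> 0}"
  have S_eq: "S = ball c \<rho> \<inter> P -` (- {0})"
    by (auto simp: S_def)
  have "open S"
    unfolding S_eq
    by (rule continuous_open_preimage) (auto intro: continuous_on_subset[OF cont])
  have clS: "closure S \<subseteq> cball c \<rho>"
    by (rule closure_minimal) (auto simp: S_def)
  have "norm (P z) \<le> 0"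
  proof (rule maximum_modulus_frontier[of P S])
    show "P holomorphic_on interior S"
      using holo \<open>open S\<close> by (simp add: interior_open S_def)
    show "continuous_on (closure S) P"
      using cont clS continuous_on_subset by blast
    show "bounded S"
      by (rule bounded_subset[of "ball c \<rho>"]) (auto simp: S_def)
    show "z \<in> S"
      using z nz sph[of z] by (auto simp: S_def dist_commute less_le)
    fix w assume w: "w \<in> frontier S"
    then have "w \<in> cball c \<rho>" "w \<notin> S"
      using clS \<open>open S\<close> by (auto simp: frontier_def interior_open)
    then show "norm (P w) \<le> 0"
      using sph[of w] by (auto simp: S_def less_le)
  qed
  with nz show False by simp
qed

text \<open>
  The substitution \<open>w = \<zeta> + d z\<^sup>2\<close> opens the slit to the real axis, so that \<open>E\<close> can be extended by 0 to
  the lower half-plane. Of the four quarter-turn rotates about \<open>i s\<close> of any point of the circle of radius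
  \<open>2 s\<close>, one lies in the lower half-plane; so the product of the rotates of this extension
  vanishes on that circle, hence at its center by the maximum principle.
\<close>

lemma vanishes_beyond_slit:
  fixes E :: "complex \<Rightarrow> complex"
  assumes cont: "continuous_on (ball \<zeta> r) E"
    and holo: "E holomorphic_on {w \<in> ball \<zeta> r. E w \<noteq> 0}"
    and slit: "\<And>t. 0 \<le> t \<Longrightarrow> t < r \<Longrightarrow> E (\<zeta> + of_real t * d) = 0"
    and d: "norm d = 1" and t: "0 < t" "9 * t < r"
  shows "E (\<zeta> - of_real t * d) = 0"
proof -
  define s R where "s = sqrt t" and "R = sqrt r"
  define \<phi> where "\<phi> = (\<lambda>z. \<zeta> + d * z\<^sup>2)"
  define E2 where "E2 = (\<lambda>z. if 0 \<le> Im z then E (\<phi> z) else 0)"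
  have s: "0 < s" "s\<^sup>2 = t" using t by (auto simp: s_def)
  \<comment> \<open>In terms of square roots \<open>9 * t < r\<close> reads
    \<open>3 * s < R\<close>: the closed disc of radius \<open>2 * s\<close> about
    \<open>\<i> * s\<close>, which the rotations preserve, lies in \<open>ball 0 R\<close>.\<close>
  have "3 * s = sqrt (9 * t)" by (simp add: s_def real_sqrt_mult)
  then have R: "3 * s < R" using t by (simp add: R_def)
  have \<phi>_ball: "\<phi> z \<in> ball \<zeta> r" if "z \<in> ball 0 R" for z
  proof -
    have "(norm z)\<^sup>2 < R\<^sup>2"
      using that by (intro power_strict_mono) auto
    then show ?thesis
      using t by (simp add: \<phi>_def dist_norm norm_mult d norm_power R_def)
  qed
  \<comment> \<open>On the real axis \<open>z\<^sup>2\<close> is nonnegative, so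
    \<open>\<phi>\<close> lands on the slit; this makes the two halves of \<open>E2\<close> agree
    there.\<close>
  have \<phi>_real: "E (\<phi> z) = 0" if "z \<in> ball 0 R" "Im z = 0" for z
  proof -
    have "z = of_real (Re z)" using that by (simp add: complex_eq_iff)
    then have "\<phi> z = \<zeta> + of_real ((Re z)\<^sup>2) * d"
      unfolding \<phi>_def by (metis mult.commute of_real_power)
    moreover have "(Re z)\<^sup>2 < r"
    proof -
      have "\<bar>Re z\<bar> < R" using that abs_Re_le_cmod[of z] by simp
      then have "\<bar>Re z\<bar>\<^sup>2 < R\<^sup>2" by (intro power_strict_mono) auto
      then show ?thesis using t by (simp add: R_def)
    qed
    ultimately show ?thesis using slit[of "(Re z)\<^sup>2"] by simp
  qed
  have E\<phi>_cont: "continuous_on (ball 0 R) (\<lambda>z. E (\<phi> z))"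
    by (rule continuous_on_compose2[OF cont]) (use \<phi>_ball in \<open>auto simp: \<phi>_def intro!: continuous_intros\<close>)
  have E2_cont: "continuous_on (ball 0 R) E2"
  proof -
    define A B where "A = ball 0 R \<inter> {z. 0 \<le> Im z}" and "B = ball 0 R \<inter> {z. Im z \<le> 0}"
    have "continuous_on (A \<union> B) (\<lambda>z. if 0 \<le> Im z then E (\<phi> z) else 0)"
    proof (rule continuous_on_cases_local)
      show "closedin (top_of_set (A \<union> B)) A" "closedin (top_of_set (A \<union> B)) B"
      proof -
        have "closed {z. 0 \<le> Im z}" "closed {z. Im z \<le> 0}"
          by (auto simp: closed_halfspace_Im_ge closed_halfspace_Im_le)
        moreover have "A = (A \<union> B) \<inter> {z. 0 \<le> Im z}" "B = (A \<union> B) \<inter> {z. Im z \<le> 0}"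
          by (auto simp: A_def B_def)
        ultimately show "closedin (top_of_set (A \<union> B)) A" "closedin (top_of_set (A \<union> B)) B"
          by (metis closedin_closed_Int)+
      qed
      show "continuous_on A (\<lambda>z. E (\<phi> z))"
        using E\<phi>_cont by (rule continuous_on_subset) (auto simp: A_def)
      show "E (\<phi> x) = 0" if "x \<in> A \<and> \<not> 0 \<le> Im x \<or> x \<in> B \<and> 0 \<le> Im x" for x
        using that \<phi>_real[of x] by (auto simp: A_def B_def)
    qed auto
    moreover have "A \<union> B = ball 0 R" by (auto simp: A_def B_def)
    ultimately show ?thesis by (simp add: E2_def)
  qed
  have E2_holo: "E2 holomorphic_on {z \<in> ball 0 R. E2 z \<noteq> 0}"
  proof -
    have "(E \<circ> \<phi>) holomorphic_on {z \<in> ball 0 R. E2 z \<noteq> 0}"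
      by (rule holomorphic_on_compose_gen[OF _ holo])
        (use \<phi>_ball in \<open>auto simp: \<phi>_def E2_def intro!: holomorphic_intros split: if_splits\<close>)
    then show ?thesis
      by (rule holomorphic_transform) (auto simp: E2_def split: if_splits)
  qed
  \<comment> \<open>Since \<open>(\<i> * s)\<^sup>2 = - t\<close>, the map \<open>\<phi>\<close>
    sends \<open>c\<close> to the point at which vanishing is claimed.\<close>
  define c where "c = \<i> * of_real s"
  define rot where "rot = (\<lambda>k z. c + \<i> ^ k * (z - c))"
  define P where "P = (\<lambda>z. \<Prod>k<4::nat. E2 (rot k z))"
  have rot_ball: "rot k z \<in> ball 0 R" if "z \<in> cball c (2 * s)" for k z
  proof -
    have "norm (rot k z) \<le> norm c + norm (z - c)"
      unfolding rot_def by (rule order.trans[OF norm_triangle_ineq]) (simp add: norm_mult norm_power)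
    also have "\<dots> \<le> s + 2 * s"
      using that s by (simp add: c_def norm_mult dist_norm norm_minus_commute)
    finally show ?thesis using R by simp
  qed
  have "P c = 0"
  proof (rule vanishes_if_boundary_zero[of c "2 * s" P])
    show "continuous_on (cball c (2 * s)) P"
    proof -
      have "continuous_on (cball c (2 * s)) (\<lambda>z. E2 (rot k z))" for k
        by (rule continuous_on_compose2[OF E2_cont])
          (use rot_ball in \<open>auto simp: rot_def intro!: continuous_intros\<close>)
      then show ?thesis unfolding P_def by (intro continuous_on_prod) auto
    qed
    show "P holomorphic_on {z \<in> ball c (2 * s). P z \<noteq> 0}"
    proof -
      have "(\<lambda>z. \<Prod>k<4::nat. (E2 \<circ> rot k) z) holomorphic_on {z \<in> ball c (2 * s). P z \<noteq> 0}"
      proof (intro holomorphic_on_prod)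
        fix k :: nat assume "k \<in> {..<4}"
        then show "(E2 \<circ> rot k) holomorphic_on {z \<in> ball c (2 * s). P z \<noteq> 0}"
          by (intro holomorphic_on_compose_gen[OF _ E2_holo])
            (use rot_ball in \<open>auto simp: rot_def P_def intro!: holomorphic_intros\<close>)
      qed
      then show ?thesis by (simp add: P_def o_def)
    qed
    show "P z = 0" if "z \<in> sphere c (2 * s)" for z
    proof -
      define v where "v = z - c"
      have v: "norm v = 2 * s" using that by (simp add: v_def dist_norm norm_minus_commute)
      have "(Re v)\<^sup>2 + (Im v)\<^sup>2 = (2 * s)\<^sup>2" using v by (metis cmod_power2)
      then have "s\<^sup>2 < (Re v)\<^sup>2 \<or> s\<^sup>2 < (Im v)\<^sup>2"
        using s t by (simp add: power_mult_distrib) linarith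
      then have "s < \<bar>Re v\<bar> \<or> s < \<bar>Im v\<bar>"
        using s by (metis abs_of_pos abs_le_square_iff linorder_not_less)
      \<comment> \<open>For \<open>k\<close> = 0, 1, 2, 3 the value \<open>Im (rot k z)\<close> is
        \<open>s\<close> plus \<open>Im v\<close>, \<open>Re v\<close>, \<open>- Im v\<close>,
        \<open>- Re v\<close>, and one of these four is below \<open>- s\<close>.\<close>
      then have "\<exists>k\<in>{0,1,2,3}. Im (rot k z) < 0"
        by (auto simp: rot_def c_def v_def eval_nat_numeral)
      then obtain k where k: "k \<in> {0,1,2,3}" "Im (rot k z) < 0" by blast
      then have "k < 4" by auto
      from k have "E2 (rot k z) = 0" by (simp add: E2_def)
      then show ?thesis using \<open>k < 4\<close> by (auto simp: P_def)
    qed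
  qed (use s in auto)
  \<comment> \<open>Every rotation fixes \<open>c\<close>, so \<open>P c\<close> is the fourth power
    of \<open>E2 c\<close>.\<close>
  then have "E2 c = 0" by (simp add: P_def rot_def)
  moreover have "\<phi> c = \<zeta> - of_real t * d"
    using s by (simp add: \<phi>_def c_def power_mult_distrib flip: of_real_power)
  ultimately show ?thesis using s by (simp add: E2_def c_def)
qed

section \<open>Horizontal shears of the upper half-plane\<close>

text \<open>Since \<open>p\<close> is injective and keeps heights, the difference of real parts over
  a horizontal displacement \<open>s > 0\<close> is never 0. The pairs of a point and a displacement
  form a convex set, so the sign of this difference is the same on all horizontal lines;
  \<open>\<tau>\<close> records it.\<close>

lemma horizontal_shear_monotone:
  fixes p :: "complex \<Rightarrow> complex"
  assumes cont: "continuous_on upper_half_plane p" and inj: "inj_on p upper_half_plane"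
    and Im_p: "\<And>w. w \<in> upper_half_plane \<Longrightarrow> Im (p w) = Im w"
  obtains \<tau> :: real where "\<bar>\<tau>\<bar> = 1"
    "\<And>v w. v \<in> upper_half_plane \<Longrightarrow> Im v = Im w \<Longrightarrow> Re v < Re w \<Longrightarrow> \<tau> * Re (p v) < \<tau> * Re (p w)"
proof -
  define T where "T = upper_half_plane \<times> {0::real<..}"
  define k where "k = (\<lambda>(w, s). Re (p (w + of_real s)) - Re (p w))"
  have "convex upper_half_plane"
    by (simp add: upper_half_plane_def convex_halfspace_Im_gt)
  then have "convex T"
    unfolding T_def by (intro convex_Times) auto
  have "continuous_on T k"
    unfolding k_def case_prod_unfold
    by (intro continuous_intros continuous_on_compose2[OF cont])
      (auto simp: T_def upper_half_plane_def)
  then have conn: "connected (k ` T)"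
    using \<open>convex T\<close> convex_connected connected_continuous_image by blast
  have nz: "k z \<noteq> 0" if zT: "z \<in> T" for z
  proof
    assume "k z = 0"
    moreover obtain w s where z: "z = (w, s)" "w \<in> upper_half_plane" "0 < s"
      using zT by (auto simp: T_def)
    moreover have ws: "w + of_real s \<in> upper_half_plane"
      using z by (simp add: upper_half_plane_def)
    ultimately have "p (w + of_real s) = p w"
      by (simp add: complex_eq_iff Im_p k_def)
    then show False using inj z ws by (auto dest: inj_onD)
  qed
  have sgn: "(\<forall>z\<in>T. 0 < k z) \<or> (\<forall>z\<in>T. k z < 0)"
  proof (rule ccontr)
    assume "\<not> ?thesis"
    then obtain y z where "y \<in> T" "z \<in> T" "k y \<le> 0" "0 \<le> k z"
      by (auto simp: not_less)
    then have "0 \<in> k ` T"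
      using connectedD_interval[OF conn, of "k y" "k z" 0] by auto
    then show False using nz by auto
  qed
  have k_diff: "\<exists>z\<in>T. k z = Re (p w) - Re (p v)"
    if "v \<in> upper_half_plane" "Im v = Im w" "Re v < Re w" for v w
  proof -
    have "w = v + of_real (Re w - Re v)" using that by (simp add: complex_eq_iff)
    then have "k (v, Re w - Re v) = Re (p w) - Re (p v)" by (simp add: k_def)
    then show ?thesis using that by (intro bexI[of _ "(v, Re w - Re v)"]) (auto simp: T_def)
  qed
  from sgn show ?thesis
  proof
    assume "\<forall>z\<in>T. 0 < k z"
    then show ?thesis using that[of 1] k_diff by fastforce
  next
    assume "\<forall>z\<in>T. k z < 0"
    then show ?thesis using that[of "-1"] k_diff by fastforce
  qed
qed

text \<open>A homeomorphism is proper: as a point of \<open>\<Omega>\<close> approaches the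
  boundary, its image leaves every compact subset of the half-plane. Near the tip of an omitted ray
  the heights stay in a compact range, so it is \<open>Re G\<close> that becomes unbounded, and
  monotonicity along horizontal lines fixes its sign.\<close>

lemma horizontal_shear_onto:
  fixes G p :: "complex \<Rightarrow> complex"
  assumes "open \<Omega>" and holG: "G holomorphic_on \<Omega>"
    and homeo: "homeomorphism \<Omega> upper_half_plane (\<lambda>w. Complex (Re (G w)) (Im w)) p"
  shows "\<Omega> = upper_half_plane"
proof (rule ccontr)
  assume neq: "\<Omega> \<noteq> upper_half_plane"
  define q where "q = (\<lambda>w. Complex (Re (G w)) (Im w))"
  have q: "q w \<in> upper_half_plane" "p (q w) = w" if "w \<in> \<Omega>" for w
    using homeo that unfolding homeomorphism_def q_def by auto
  have p: "p w \<in> \<Omega>" "q (p w) = w" if "w \<in> upper_half_plane" for w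
    using homeo that unfolding homeomorphism_def q_def by auto
  have p_cont: "continuous_on upper_half_plane p"
    using homeo by (simp add: homeomorphism_def)
  have Re_q: "Re (q w) = Re (G w)" and Im_q: "Im (q w) = Im w" for w
    by (simp_all add: q_def)
  have Im_p: "Im (p w) = Im w" if "w \<in> upper_half_plane" for w
    using p[OF that] Im_q by metis
  have sub: "\<Omega> \<subseteq> upper_half_plane"
    using q Im_q by (force simp: upper_half_plane_def)
  obtain \<tau> :: real where \<tau>: "\<bar>\<tau>\<bar> = 1"
    "\<And>v w. v \<in> upper_half_plane \<Longrightarrow> Im v = Im w \<Longrightarrow> Re v < Re w \<Longrightarrow> \<tau> * Re (p v) < \<tau> * Re (p w)"
    using horizontal_shear_monotone[OF p_cont inj_on_inverseI[of _ q p] Im_p] p(2) by blast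
  \<comment> \<open>The inverse of a strictly monotone function is monotone in the same direction,
    so the sign \<open>\<tau>\<close> of \<open>p\<close> also serves for \<open>q\<close>.\<close>
  have mono: "\<tau> * Re (G b) < \<tau> * Re (G w)"
    if "b \<in> \<Omega>" "w \<in> \<Omega>" "Im b = Im w" "Re b < Re w" for b w
  proof -
    have *: "q b \<in> upper_half_plane" "q w \<in> upper_half_plane" "Im (q b) = Im (q w)" "p (q b) = b" "p (q w) = w"
      using that q Im_q by auto
    have "Re (q b) \<noteq> Re (q w)"
      using * that by (metis complex_eqI less_irrefl)
    moreover have "\<tau> = 1 \<or> \<tau> = -1" using \<tau>(1) by auto
    ultimately show ?thesis
      using \<tau>(2)[of "q b" "q w"] \<tau>(2)[of "q w" "q b"] * that by (auto simp: Re_q linorder_neq_iff)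
  qed
  obtain w' where w': "w' \<in> upper_half_plane" "w' \<notin> \<Omega>" using neq sub by auto
  define y where "y = Im w'"
  have y: "0 < y" using w' by (simp add: y_def upper_half_plane_def)
  \<comment> \<open>\<open>p\<close> keeps heights, so \<open>p w'\<close> is a point of
    \<open>\<Omega>\<close> on the horizontal line through the omitted point.\<close>
  define a where "a = Re (p w')"
  have pw': "p w' = Complex a y" using Im_p[OF w'(1)] by (simp add: a_def y_def complex_eq_iff)
  have a: "Complex a y \<in> \<Omega>" using p(1)[OF w'(1)] pw' by simp
  define I where "I = {x. Complex x y \<in> \<Omega>}"
  \<comment> \<open>The slice of \<open>\<Omega>\<close> at height \<open>y\<close> is the image
    under \<open>p\<close> of the full horizontal line, hence an interval.\<close>
  have "I = (\<lambda>x. Re (p (Complex x y))) ` UNIV"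
  proof safe
    fix x assume "x \<in> I"
    then have "Complex x y \<in> \<Omega>" by (simp add: I_def)
    then have "p (Complex (Re (q (Complex x y))) y) = Complex x y"
      using q(2)[of "Complex x y"] Im_q[of "Complex x y"] by (metis complex.collapse complex.sel(2))
    then have "x = Re (p (Complex (Re (q (Complex x y))) y))" by simp
    then show "x \<in> range (\<lambda>x. Re (p (Complex x y)))" by blast
  next
    fix x
    have "Complex x y \<in> upper_half_plane" using y by (simp add: upper_half_plane_def)
    then have "p (Complex x y) \<in> \<Omega>" "Im (p (Complex x y)) = y" using p Im_p by auto
    then show "Re (p (Complex x y)) \<in> I" unfolding I_def by (metis complex.collapse mem_Collect_eq)
  qed
  moreover have "continuous_on UNIV (\<lambda>x. Re (p (Complex x y)))"
    by (intro continuous_intros continuous_on_compose2[OF p_cont])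
      (auto simp: upper_half_plane_def y Complex_eq intro!: continuous_intros)
  ultimately have "connected I" by (metis connected_UNIV connected_continuous_image)
  then have I_int: "x \<in> I" if "u \<in> I" "v \<in> I" "u \<le> x" "x \<le> v" for u v x
    using that connectedD_interval by blast
  define \<epsilon> where "\<epsilon> = sgn (Re w' - a)"
  have "Re w' \<noteq> a" using w' a by (metis complex.collapse y_def)
  then have \<epsilon>: "\<epsilon> = 1 \<or> \<epsilon> = -1" by (auto simp: \<epsilon>_def sgn_if)
  \<comment> \<open>Distances at which the ray from \<open>a\<close> towards the omitted point is
    outside the slice. This set is closed, so there is a first exit distance \<open>t0\<close>; it
    gives the tip \<open>\<zeta>\<close> of the omitted ray.\<close>
  define A where "A = {t. 0 \<le> t \<and> a + \<epsilon> * t \<notin> I}"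
  have "open I"
  proof -
    have "I = (\<lambda>x. Complex x y) -` \<Omega>" by (auto simp: I_def)
    then show ?thesis using \<open>open \<Omega>\<close>
      by (simp add: Complex_eq open_vimage continuous_intros)
  qed
  then have "open ((\<lambda>t. a + \<epsilon> * t) -` I)" by (intro open_vimage continuous_intros)
  moreover have A_eq: "A = {0..} \<inter> - ((\<lambda>t. a + \<epsilon> * t) -` I)" by (auto simp: A_def)
  ultimately have "closed A" by (simp add: closed_Int open_closed)
  have "\<bar>Re w' - a\<bar> \<in> A"
    using w' by (auto simp: A_def I_def \<epsilon>_def y_def abs_if sgn_if)
  then obtain t0 where t0: "t0 \<in> A" "\<And>t. t \<in> A \<Longrightarrow> t0 \<le> t"
    using \<open>closed A\<close> closed_contains_Inf[of A] cInf_lower[of _ A]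
    by (metis A_def bdd_below.I empty_iff mem_Collect_eq)
  have "a \<in> I" using a by (simp add: I_def)
  have "0 < t0" using t0(1) \<open>a \<in> I\<close> by (auto simp: A_def less_le)
  define \<zeta> where "\<zeta> = Complex (a + \<epsilon> * t0) y"
  have before: "\<zeta> - of_real t * of_real \<epsilon> \<in> \<Omega>" if "0 < t" "t \<le> t0" for t
  proof -
    have "t0 - t \<notin> A" using t0(2)[of "t0 - t"] that by auto
    then have "a + \<epsilon> * (t0 - t) \<in> I" using that by (auto simp: A_def)
    moreover have "\<zeta> - of_real t * of_real \<epsilon> = Complex (a + \<epsilon> * (t0 - t)) y"
      by (simp add: \<zeta>_def complex_eq_iff algebra_simps)
    ultimately show ?thesis by (simp add: I_def)
  qed
  \<comment> \<open>The slice is an interval containing \<open>a\<close>, so the ray cannot re-enter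
    it after the first exit.\<close>
  have slit: "\<zeta> + of_real t * of_real \<epsilon> \<notin> \<Omega>" if "0 \<le> t" for t
  proof
    assume "\<zeta> + of_real t * of_real \<epsilon> \<in> \<Omega>"
    moreover have "\<zeta> + of_real t * of_real \<epsilon> = Complex (a + \<epsilon> * (t0 + t)) y"
      by (simp add: \<zeta>_def complex_eq_iff algebra_simps)
    ultimately have "a + \<epsilon> * (t0 + t) \<in> I" by (simp add: I_def)
    moreover have "a + \<epsilon> * t0 \<notin> I" using t0(1) by (simp add: A_def)
    ultimately show False
      using \<epsilon> I_int[of a "a + \<epsilon> * (t0 + t)" "a + \<epsilon> * t0"] I_int[of "a + \<epsilon> * (t0 + t)" a "a + \<epsilon> * t0"]
        \<open>a \<in> I\<close> \<open>0 < t0\<close> that by auto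
  qed
  obtain \<delta>' where \<delta>': "0 < \<delta>'" "cball (Complex a y) \<delta>' \<subseteq> \<Omega>"
    using \<open>open \<Omega>\<close> a open_contains_cball by blast
  \<comment> \<open>The bound \<open>y / 2\<close> keeps the boxes used for properness inside the
    half-plane; \<open>\<delta>'\<close> keeps the vertical segment through
    \<open>Complex a y\<close> inside \<open>\<Omega>\<close>.\<close>
  define \<delta> where "\<delta> = min \<delta>' (y / 2)"
  have \<delta>: "0 < \<delta>" "\<delta> < y" "\<delta> \<le> \<delta>'" using \<delta>' y by (auto simp: \<delta>_def)
  have vert: "Complex a x \<in> cball (Complex a y) \<delta>'" if "\<bar>x - y\<bar> \<le> \<delta>" for x
    using that \<delta> by (auto simp: dist_norm cmod_def)
  have "compact ((\<lambda>z. Re (G z)) ` cball (Complex a y) \<delta>')"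
    by (intro compact_continuous_image continuous_intros
        continuous_on_subset[OF holomorphic_on_imp_continuous_on[OF holG] \<delta>'(2)]) auto
  then obtain m where m: "\<And>z. z \<in> cball (Complex a y) \<delta>' \<Longrightarrow> \<bar>Re (G z)\<bar> \<le> m"
    by (metis bounded_iff compact_imp_bounded image_eqI real_norm_def)
  \<comment> \<open>\<open>r \<le> \<delta>\<close> confines the heights in the ball about
    \<open>\<zeta>\<close>, and \<open>r \<le> t0\<close> keeps the ball on one side of the vertical
    line with real part \<open>a\<close>.\<close>
  define r where "r = min \<delta> t0"
  have r: "0 < r" "r \<le> \<delta>" "r \<le> t0" using \<delta> \<open>0 < t0\<close> by (auto simp: r_def)
  \<comment> \<open>With this sign \<open>\<sigma> * Re G\<close> increases in the direction
    \<open>\<epsilon>\<close>, away from \<open>a\<close>. It is thus bounded below near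
    \<open>\<zeta>\<close>, and \<open>exp (- \<sigma> * G)\<close> is the choice that decays at the
    boundary.\<close>
  define \<sigma> where "\<sigma> = \<epsilon> * \<tau>"
  have \<sigma>: "\<sigma> = 1 \<or> \<sigma> = -1" using \<epsilon> \<tau>(1) by (auto simp: \<sigma>_def)
  have ball: "\<bar>Im w - y\<bar> < \<delta>" "0 < \<epsilon> * (Re w - a)" if "w \<in> ball \<zeta> r" for w
  proof -
    have "norm (w - \<zeta>) < r" using that by (simp add: dist_norm norm_minus_commute)
    then have *: "\<bar>Re w - (a + \<epsilon> * t0)\<bar> < r" "\<bar>Im w - y\<bar> < r"
      using abs_Re_le_cmod[of "w - \<zeta>"] abs_Im_le_cmod[of "w - \<zeta>"] by (auto simp: \<zeta>_def)
    then show "\<bar>Im w - y\<bar> < \<delta>" using r by simp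
    show "0 < \<epsilon> * (Re w - a)" using * \<epsilon> r by auto
  qed
  \<comment> \<open>compare with the compact vertical segment through \<open>Complex a y\<close>, using monotonicity on horizontal lines\<close>
  have lower: "- m \<le> \<sigma> * Re (G w)" if w: "w \<in> ball \<zeta> r" "w \<in> \<Omega>" for w
  proof -
    define b where "b = Complex a (Im w)"
    have b: "b \<in> cball (Complex a y) \<delta>'" using vert[of "Im w"] ball[OF w(1)] by (simp add: b_def)
    then have "b \<in> \<Omega>" using \<delta>' by blast
    from \<epsilon> have "\<sigma> * Re (G b) < \<sigma> * Re (G w)"
    proof
      assume "\<epsilon> = 1"
      then have "Re b < Re w" using ball(2)[OF w(1)] by (simp add: b_def)
      from mono[OF \<open>b \<in> \<Omega>\<close> w(2) _ this] show ?thesis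
        by (simp add: \<sigma>_def b_def \<open>\<epsilon> = 1\<close>)
    next
      assume "\<epsilon> = -1"
      then have "Re w < Re b" using ball(2)[OF w(1)] by (simp add: b_def)
      from mono[OF w(2) \<open>b \<in> \<Omega>\<close> _ this] show ?thesis
        by (simp add: \<sigma>_def b_def \<open>\<epsilon> = -1\<close>)
    qed
    then show ?thesis using m[OF b] \<sigma> by auto
  qed
  define E where "E = (\<lambda>w. if w \<in> \<Omega> then exp (- of_real \<sigma> * G w) else 0)"
  have E_holo: "E holomorphic_on \<Omega>"
  proof (rule holomorphic_transform)
    show "(\<lambda>w. exp (- of_real \<sigma> * G w)) holomorphic_on \<Omega>"
      by (intro holomorphic_intros holG)
  qed (simp add: E_def)
  have E_cont: "continuous_on (ball \<zeta> r) E"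
  proof (rule continuous_at_imp_continuous_on, rule ballI)
    fix w0 assume w0: "w0 \<in> ball \<zeta> r"
    show "isCont E w0"
    proof (cases "w0 \<in> \<Omega>")
      case True
      then show ?thesis
        using E_holo \<open>open \<Omega>\<close> holomorphic_on_imp_continuous_on continuous_on_eq_continuous_at by blast
    next
      case False
      have "\<forall>\<^sub>F w in at w0. norm (E w) < e" if "0 < e" for e
      proof -
        \<comment> \<open>Once \<open>\<bar>Re (G w)\<bar>\<close> exceeds \<open>N\<close>, the
          part \<open>m\<close> excludes large negative values of
          \<open>\<sigma> * Re (G w)\<close>, and the part \<open>- ln e\<close> makes the
          exponential smaller than \<open>e\<close>.\<close>
        define N where "N = max m (- ln e)"
        \<comment> \<open>\<open>K\<close> is a compact subset of \<open>\<Omega>\<close> and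
          \<open>w0\<close> is outside \<open>\<Omega>\<close>, so points near \<open>w0\<close>
          avoid \<open>K\<close>; for those in \<open>\<Omega>\<close>, \<open>q w\<close> avoids
          the box.\<close>
        define K where "K = p ` cbox (Complex (- N) (y - \<delta>)) (Complex N (y + \<delta>))"
        have K_sub: "cbox (Complex (- N) (y - \<delta>)) (Complex N (y + \<delta>)) \<subseteq> upper_half_plane"
          using \<delta> by (auto simp: in_cbox_complex_iff upper_half_plane_def)
        then have "compact K"
          unfolding K_def by (intro compact_continuous_image continuous_on_subset[OF p_cont]) auto
        moreover have "w0 \<notin> K" using False K_sub p by (auto simp: K_def)
        ultimately have "\<forall>\<^sub>F w in at w0. w \<in> - K"
          by (intro topological_tendstoD[OF tendsto_ident_at]) (auto simp: compact_imp_closed open_Compl)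
        moreover have "\<forall>\<^sub>F w in at w0. w \<in> ball \<zeta> r"
          using w0 by (intro topological_tendstoD[OF tendsto_ident_at]) auto
        ultimately show ?thesis
        proof eventually_elim
          case (elim w)
          show ?case
          proof (cases "w \<in> \<Omega>")
            case True
            have "q w \<notin> cbox (Complex (- N) (y - \<delta>)) (Complex N (y + \<delta>))"
              using elim q(2)[OF True] unfolding K_def by (metis ComplD imageI)
            then have "N < \<bar>Re (G w)\<bar>"
              using ball(1)[of w] elim by (auto simp: in_cbox_complex_iff Re_q Im_q)
            then have "N < \<sigma> * Re (G w)"
              using lower[of w] elim True \<sigma> by (auto simp: N_def)
            then have "- (\<sigma> * Re (G w)) < ln e" by (simp add: N_def)
            then have "exp (- (\<sigma> * Re (G w))) < e"
              using that by (metis exp_less_mono exp_ln)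
            then show ?thesis using True by (simp add: E_def)
          qed (simp add: E_def that)
        qed
      qed
      then have "(E \<longlongrightarrow> 0) (at w0)" by (auto simp: tendsto_iff)
      then show ?thesis using False by (simp add: isCont_def E_def)
    qed
  qed
  \<comment> \<open>Small enough for \<open>9 * t < r\<close> and \<open>t \<le> t0\<close>. The
    point reached is in \<open>\<Omega>\<close>, where \<open>E\<close> is an exponential and cannot
    vanish.\<close>
  define t where "t = r / 10"
  have "E (\<zeta> - of_real t * of_real \<epsilon>) = 0"
  proof (rule vanishes_beyond_slit[OF E_cont])
    show "E holomorphic_on {w \<in> ball \<zeta> r. E w \<noteq> 0}"
      using E_holo by (rule holomorphic_on_subset) (auto simp: E_def split: if_splits)
    show "norm (of_real \<epsilon> :: complex) = 1" using \<epsilon> by auto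
  qed (use slit r in \<open>auto simp: t_def E_def\<close>)
  moreover have "\<zeta> - of_real t * of_real \<epsilon> \<in> \<Omega>"
    using before[of t] r by (simp add: t_def)
  ultimately show False by (simp add: E_def)
qed

section \<open>Injectivity of the holomorphic shear\<close>

text \<open>If \<open>F\<close> takes one value at two points, their images under \<open>f\<close>
  have equal height, so the segment joining them stays in the half-plane. Along it
  \<open>F \<circ> p\<close> has constant imaginary part and equal end values, and Rolle's theorem
  yields a zero of its derivative.\<close>

lemma harmonic_diffeo_shear_inj:
  fixes h g :: "complex \<Rightarrow> complex"
  assumes "open S" and h: "h holomorphic_on S" and g: "g holomorphic_on S"
    and diffeo: "diffeo_between (\<lambda>z. h z + cnj (g z)) S upper_half_plane"
  shows "inj_on (\<lambda>z. h z - g z) S"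
proof -
  define f where "f = (\<lambda>z. h z + cnj (g z))"
  define F where "F = (\<lambda>z. h z - g z)"
  obtain p where homeo: "homeomorphism S upper_half_plane f p"
    and "p differentiable_on upper_half_plane"
    using diffeo by (auto simp: diffeo_between_def f_def)
  have "open upper_half_plane" by (simp add: upper_half_plane_def open_halfspace_Im_gt)
  have f: "f z \<in> upper_half_plane" "p (f z) = z" if "z \<in> S" for z
    using homeo that by (auto simp: homeomorphism_def)
  have p: "p w \<in> S" "f (p w) = w" if "w \<in> upper_half_plane" for w
    using homeo that by (auto simp: homeomorphism_def)
  define D where "D = (\<lambda>z t. deriv h z * t + cnj (deriv g z * t))"
  have D: "(f has_derivative D z) (at z)" if "z \<in> S" for z
  proof -
    have "(h has_derivative (*) (deriv h z)) (at z)" "(g has_derivative (*) (deriv g z)) (at z)"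
      using h g that \<open>open S\<close>
      by (simp_all add: holomorphic_derivI flip: has_field_derivative_def)
    then show ?thesis
      unfolding f_def D_def by (auto intro!: derivative_intros bounded_linear.has_derivative[OF bounded_linear_cnj]
          simp del: complex_cnj_mult)
  qed
  define P where "P = (\<lambda>w. frechet_derivative p (at w))"
  have P: "(p has_derivative P w) (at w)" if "w \<in> upper_half_plane" for w
    using \<open>p differentiable_on upper_half_plane\<close> that \<open>open upper_half_plane\<close>
    by (simp add: P_def differentiable_on_eq_differentiable_at frechet_derivative_works)
  have PD: "P (f z) (D z t) = t" if "z \<in> S" for z t
  proof -
    have "((\<lambda>z. p (f z)) has_derivative (\<lambda>t. P (f z) (D z t))) (at z)"
      using has_derivative_compose[OF D P] f that by blast
    then have "((\<lambda>z. z) has_derivative (\<lambda>t. P (f z) (D z t))) (at z)"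
      by (rule has_derivative_transform_within_open[OF _ \<open>open S\<close> that]) (use f in auto)
    then show ?thesis
      using has_derivative_unique[OF has_derivative_ident] by metis
  qed
  have DP: "D (p w) (P w t) = t" if "w \<in> upper_half_plane" for w t
  proof -
    have "((\<lambda>w. f (p w)) has_derivative (\<lambda>t. D (p w) (P w t))) (at w)"
      using has_derivative_compose[OF P D] p that by blast
    then have "((\<lambda>w. w) has_derivative (\<lambda>t. D (p w) (P w t))) (at w)"
      by (rule has_derivative_transform_within_open[OF _ \<open>open upper_half_plane\<close> that]) (use p in auto)
    then show ?thesis
      using has_derivative_unique[OF has_derivative_ident] by metis
  qed
  have F'_nz: "deriv h z - deriv g z \<noteq> 0" if "z \<in> S" for z
  proof
    assume eq: "deriv h z - deriv g z = 0"
    \<comment> \<open>If \<open>deriv h z\<close> and \<open>deriv g z\<close> have a common value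
      \<open>b\<close>, then \<open>D z t\<close> is \<open>2 * Re (b * t)\<close>. The choice
      \<open>t = \<i> * cnj b\<close> makes \<open>b * t\<close> purely imaginary; for
      \<open>b = 0\<close> any nonzero \<open>t\<close> lies in the kernel.\<close>
    define t where "t = (if deriv h z = 0 then 1 else \<i> * cnj (deriv h z))"
    have "D z t = 0"
      using eq by (auto simp: D_def t_def complex_eq_iff)
    moreover have "D z 0 = 0" by (simp add: D_def)
    ultimately have "t = 0" using PD[OF that, of t] PD[OF that, of 0] by simp
    then show False by (auto simp: t_def split: if_splits)
  qed
  have Im_F: "Im (F z) = Im (f z)" for z by (simp add: F_def f_def)
  have False if z: "z1 \<in> S" "z2 \<in> S" "F z1 = F z2" and less: "Re (f z1) < Re (f z2)" for z1 z2
  proof -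
    define y where "y = Im (f z1)"
    have y: "0 < y" "Im (f z2) = y"
      using f[OF z(1)] z(3) Im_F[of z1] Im_F[of z2] by (auto simp: y_def upper_half_plane_def)
    have U: "Complex x y \<in> upper_half_plane" for x using y by (simp add: upper_half_plane_def)
    define \<psi> where "\<psi> = (\<lambda>x. F (p (Complex x y)))"
    define d where "d = (\<lambda>x. deriv h (p (Complex x y)) - deriv g (p (Complex x y)))"
    have \<psi>: "(\<psi> has_derivative (\<lambda>s. d x * P (Complex x y) (of_real s))) (at x)" for x
    proof -
      have "(F has_field_derivative d x) (at (p (Complex x y)))"
        using h g p(1)[OF U] \<open>open S\<close> unfolding F_def d_def
        by (intro derivative_intros) (auto intro: holomorphic_derivI)
      then have F': "(F has_derivative (*) (d x)) (at (p (Complex x y)))"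
        by (simp add: has_field_derivative_def)
      have "((\<lambda>x. Complex x y) has_derivative of_real) (at x)"
        unfolding Complex_eq by (auto intro!: derivative_eq_intros)
      from has_derivative_compose[OF this P[OF U]]
      have "((\<lambda>x. p (Complex x y)) has_derivative (\<lambda>s. P (Complex x y) (of_real s))) (at x)" .
      from has_derivative_compose[OF this F'] show ?thesis by (simp add: \<psi>_def)
    qed
    have Im_\<psi>: "Im (\<psi> x) = y" for x using p(2)[OF U] by (simp add: \<psi>_def Im_F)
    have Re': "((\<lambda>x. Re (\<psi> x)) has_derivative (\<lambda>s. Re (d x * P (Complex x y) (of_real s)))) (at x)"
      and Im': "((\<lambda>x. Im (\<psi> x)) has_derivative (\<lambda>s. Im (d x * P (Complex x y) (of_real s)))) (at x)" for x
      by (rule bounded_linear.has_derivative[OF bounded_linear_Re \<psi>]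
          bounded_linear.has_derivative[OF bounded_linear_Im \<psi>])+
    have ends: "\<psi> (Re (f z1)) = F z1" "\<psi> (Re (f z2)) = F z2"
      using f z y unfolding \<psi>_def y_def by (metis complex.collapse)+
    have "continuous_on {Re (f z1)..Re (f z2)} (\<lambda>x. Re (\<psi> x))"
      using Re' by (meson continuous_at_imp_continuous_on has_derivative_continuous)
    then obtain x where x: "(\<lambda>s. Re (d x * P (Complex x y) (of_real s))) = (\<lambda>s. 0)"
      using Rolle_deriv[OF less _ _ Re'] ends z(3) by auto
    have "(\<lambda>s. Im (d x * P (Complex x y) (of_real s))) = (\<lambda>s. 0)"
      using Im'[of x] has_derivative_const by (intro has_derivative_unique) (auto simp: Im_\<psi>)
    from fun_cong[OF this, of 1] fun_cong[OF x, of 1] have "d x * P (Complex x y) 1 = 0"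
      by (simp add: complex_eq_iff)
    \<comment> \<open>\<open>d x\<close> is the derivative of the shear and is nonzero, so the
      differential of \<open>p\<close> would kill the horizontal direction, although
      \<open>D\<close> inverts it.\<close>
    then have "P (Complex x y) 1 = 0" using F'_nz[OF p(1)[OF U]] by (simp add: d_def)
    then show False using DP[OF U, of x 1] by (simp add: D_def)
  qed
  moreover have "z1 = z2" if "z1 \<in> S" "z2 \<in> S" "F z1 = F z2" "Re (f z1) = Re (f z2)" for z1 z2
    using that f Im_F by (metis complex_eqI)
  ultimately have "inj_on F S"
    by (intro inj_onI) (metis linorder_neqE_linordered_idom)
  then show ?thesis by (simp add: F_def)
qed

section \<open>Conformal maps of the disc onto the half-plane\<close>

text \<open>Followed by the Moebius map of the half-plane onto the disc that takes
  \<open>F 0\<close> to 0, \<open>F\<close> becomes a disc automorphism fixing 0, hence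
  multiplication by a unimodular \<open>\<alpha>\<close>. Solving for \<open>F\<close> gives
  \<open>2 * Im c / (norm (1 - \<alpha> * z))\<^sup>2\<close> as the norm of the derivative, with
  denominator at most 4.\<close>

lemma deriv_bound_disc_onto_half_plane:
  assumes F: "F holomorphic_on ball 0 1" and inj: "inj_on F (ball 0 1)"
    and onto: "F ` ball 0 1 = upper_half_plane" and z: "z \<in> ball 0 1"
  shows "Im (F 0) / 2 \<le> norm (deriv F z)"
proof -
  define c where "c = F 0"
  have Im_pos: "0 < Im (F z)" if "z \<in> ball 0 1" for z
    using onto that by (auto simp: upper_half_plane_def)
  have c: "0 < Im c" using Im_pos[of 0] by (simp add: c_def)
  obtain k where k: "k holomorphic_on upper_half_plane" "\<And>z. z \<in> ball 0 1 \<Longrightarrow> k (F z) = z"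
    using holomorphic_has_inverse[OF F open_ball inj] unfolding onto by blast
  have k_ball: "k w \<in> ball 0 1" if "w \<in> upper_half_plane" for w
    using that k(2) onto by (metis imageE)
  define \<phi> where "\<phi> = (\<lambda>z. (F z - c) / (F z - cnj c))"
  \<comment> \<open>the inverse of \<open>\<phi>\<close>; applying the Schwarz lemma to both gives equality\<close>
  define \<kappa> where "\<kappa> = (\<lambda>v. k ((c - cnj c * v) / (1 - v)))"
  have nz: "F z - cnj c \<noteq> 0" if "z \<in> ball 0 1" for z
    using Im_pos[OF that] c by (auto simp: complex_eq_iff)
  have \<phi>_holo: "\<phi> holomorphic_on ball 0 1"
    unfolding \<phi>_def using nz by (intro holomorphic_intros F) auto
  have \<phi>_less: "norm (\<phi> z) < 1" if "norm z < 1" for z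
  proof -
    have "(norm (F z - c))\<^sup>2 < (norm (F z - cnj c))\<^sup>2"
      using c Im_pos[of z] that by (simp add: cmod_power2) (simp add: power2_eq_square algebra_simps)
    then have "norm (F z - c) < norm (F z - cnj c)" by (simp add: power2_less_imp_less)
    then show ?thesis using nz[of z] that by (simp add: \<phi>_def norm_divide)
  qed
  have \<kappa>_arg: "(c - cnj c * v) / (1 - v) \<in> upper_half_plane" if "norm v < 1" for v
  proof -
    have "v \<noteq> 1" using that by auto
    have "Re v * Re v + Im v * Im v < 1"
      using that by (metis cmod_power2 norm_ge_zero one_power2 power2_eq_square power_strict_mono zero_less_numeral)
    then have "0 < Im c * (1 - (Re v * Re v + Im v * Im v))" using c by simp
    moreover have "Im ((c - cnj c * v) * cnj (1 - v)) = Im c * (1 - (Re v * Re v + Im v * Im v))"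
      by (simp add: algebra_simps)
    ultimately show ?thesis
      using \<open>v \<noteq> 1\<close> by (simp add: upper_half_plane_def Im_complex_div_gt_0)
  qed
  have \<kappa>_holo: "\<kappa> holomorphic_on ball 0 1"
    unfolding \<kappa>_def
    by (rule holomorphic_on_compose_gen[OF _ k(1), unfolded o_def])
      (use \<kappa>_arg in \<open>auto intro!: holomorphic_intros\<close>)
  have \<kappa>_less: "norm (\<kappa> v) < 1" if "norm v < 1" for v
    using k_ball[OF \<kappa>_arg[OF that]] by (simp add: \<kappa>_def)
  have \<kappa>\<phi>: "\<kappa> (\<phi> z) = z" if "z \<in> ball 0 1" for z
  proof -
    have "(c - cnj c * \<phi> z) / (1 - \<phi> z) = F z"
    proof -
      have "c - cnj c \<noteq> 0" using c by (auto simp: complex_eq_iff)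
      then show ?thesis using nz[OF that] unfolding \<phi>_def
        by (simp add: divide_simps) (auto simp: algebra_simps)
    qed
    then show ?thesis using k(2)[OF that] by (simp add: \<kappa>_def)
  qed
  have zeros: "\<phi> 0 = 0" "\<kappa> 0 = 0"
    using k(2)[of 0] by (simp_all add: \<phi>_def \<kappa>_def c_def)
  \<comment> \<open>Any nonzero point of the disc would serve: equality there is the rigidity case
    of the Schwarz lemma.\<close>
  have "norm (\<phi> (1/2)) = norm (1/2 :: complex)"
  proof (rule antisym)
    show "norm (\<phi> (1/2)) \<le> norm (1/2 :: complex)"
      by (rule Schwarz_Lemma(1)[OF \<phi>_holo zeros(1) \<phi>_less]) auto
    have "norm (\<kappa> (\<phi> (1/2))) \<le> norm (\<phi> (1/2))"
      by (rule Schwarz_Lemma(1)[OF \<kappa>_holo zeros(2) \<kappa>_less \<phi>_less]) auto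
    then show "norm (1/2 :: complex) \<le> norm (\<phi> (1/2))" by (simp add: \<kappa>\<phi>)
  qed
  then have "\<exists>\<alpha>. (\<forall>z. norm z < 1 \<longrightarrow> \<phi> z = \<alpha> * z) \<and> norm \<alpha> = 1"
    by (intro Schwarz_Lemma(3)[OF \<phi>_holo zeros(1) \<phi>_less z[simplified]] disjI1 exI[of _ "1/2"]) auto
  then obtain \<alpha> where \<alpha>: "\<And>z. norm z < 1 \<Longrightarrow> \<phi> z = \<alpha> * z" "norm \<alpha> = 1" by blast
  have one_minus: "1 - \<alpha> * z \<noteq> 0" if "norm z < 1" for z
  proof
    assume "1 - \<alpha> * z = 0"
    then have "norm (\<alpha> * z) = 1" by simp
    then show False using that \<alpha> by (simp add: norm_mult)
  qed
  have F_eq: "F z = (c - cnj c * (\<alpha> * z)) / (1 - \<alpha> * z)" if "z \<in> ball 0 1" for z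
  proof -
    have "F z - c = \<alpha> * z * (F z - cnj c)"
      using \<alpha>(1)[of z] nz[OF that] that by (simp add: \<phi>_def divide_simps)
    then show ?thesis using one_minus[of z] that by (simp add: field_simps)
  qed
  have "((\<lambda>z. (c - cnj c * (\<alpha> * z)) / (1 - \<alpha> * z)) has_field_derivative
      \<alpha> * (c - cnj c) / (1 - \<alpha> * z)\<^sup>2) (at z)"
    using one_minus[of z] z
    by (auto intro!: derivative_eq_intros simp: divide_simps power2_eq_square) (auto simp: algebra_simps)
  then have "(F has_field_derivative \<alpha> * (c - cnj c) / (1 - \<alpha> * z)\<^sup>2) (at z)"
    by (rule has_field_derivative_transform_within_open[OF _ open_ball z]) (simp add: F_eq)
  then have "deriv F z = \<alpha> * (c - cnj c) / (1 - \<alpha> * z)\<^sup>2" by (rule DERIV_imp_deriv)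
  moreover have "norm (c - cnj c) = 2 * Im c"
    using c by (simp add: complex_diff_cnj norm_mult)
  ultimately have norm_eq: "norm (deriv F z) = 2 * Im c / (norm (1 - \<alpha> * z))\<^sup>2"
    using \<alpha>(2) by (simp add: norm_divide norm_mult norm_power)
  have "norm (1 - \<alpha> * z) \<le> 1 + norm (\<alpha> * z)"
    using norm_triangle_ineq4[of 1 "\<alpha> * z"] by simp
  also have "\<dots> \<le> 2" using \<alpha>(2) z by (simp add: norm_mult)
  finally have "(norm (1 - \<alpha> * z))\<^sup>2 \<le> 2\<^sup>2" by (intro power_mono) auto
  then have "2 * Im c / 2\<^sup>2 \<le> 2 * Im c / (norm (1 - \<alpha> * z))\<^sup>2"
    using c one_minus[of z] z by (intro divide_left_mono) auto
  then show ?thesis by (simp add: norm_eq c_def)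
qed

section \<open>The lower bound and its sharpness\<close>

lemma infdist_frontier_upper_half_plane: "infdist \<i> (frontier upper_half_plane) = 1"
proof -
  have "frontier {w. 0 < \<i> \<bullet> w} = {w. \<i> \<bullet> w = 0}" by (rule frontier_halfspace_gt) simp
  then have fr: "frontier upper_half_plane = {w. Im w = 0}"
    by (simp add: upper_half_plane_def inner_complex_def)
  have "infdist \<i> {w. Im w = 0} \<le> dist \<i> 0" by (rule infdist_le) simp
  moreover have "1 \<le> infdist \<i> {w. Im w = 0}"
  proof (subst infdist_notempty)
    show "{w. Im w = 0} \<noteq> {}" by (auto intro: exI[of _ 0])
    then show "1 \<le> (INF w\<in>{w. Im w = 0}. dist \<i> w)"
    proof (rule cINF_greatest)
      fix w assume "w \<in> {w. Im w = 0}"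
      then show "1 \<le> dist \<i> w"
        using abs_Im_le_cmod[of "\<i> - w"] by (simp add: dist_norm)
    qed
  qed
  ultimately show ?thesis by (simp add: fr)
qed

lemma admissible_pair_lower_bound:
  assumes "admissible_pair h g" and z: "z \<in> ball 0 1"
  shows "1 / 2 \<le> norm (deriv h z) + norm (deriv g z)"
proof -
  have h: "h holomorphic_on ball 0 1" and g: "g holomorphic_on ball 0 1"
    and diffeo: "diffeo_between (\<lambda>z. h z + cnj (g z)) (ball 0 1) upper_half_plane"
    and f0: "h 0 + cnj (g 0) = \<i>"
    using assms by (auto simp: admissible_pair_def)
  define f where "f = (\<lambda>z. h z + cnj (g z))"
  define F where "F = (\<lambda>z. h z - g z)"
  define \<Omega> where "\<Omega> = F ` ball 0 1"
  have F: "F holomorphic_on ball 0 1" unfolding F_def by (intro holomorphic_intros h g)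
  have inj: "inj_on F (ball 0 1)"
    unfolding F_def by (rule harmonic_diffeo_shear_inj[OF open_ball h g diffeo])
  obtain k where k: "k holomorphic_on \<Omega>" "\<And>z. z \<in> ball 0 1 \<Longrightarrow> k (F z) = z"
    using holomorphic_has_inverse[OF F open_ball inj] unfolding \<Omega>_def by blast
  have k_ball: "k w \<in> ball 0 1" if "w \<in> \<Omega>" for w using that k(2) by (auto simp: \<Omega>_def)
  have Fk: "F (k w) = w" if "w \<in> \<Omega>" for w using that k(2) by (auto simp: \<Omega>_def)
  have "open \<Omega>" unfolding \<Omega>_def by (rule open_mapping_thm3[OF F open_ball inj])
  obtain p where p: "homeomorphism (ball 0 1) upper_half_plane f p"
    using diffeo by (auto simp: diffeo_between_def f_def)
  have "homeomorphism \<Omega> (ball 0 1) k F"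
    by (rule homeomorphismI)
      (use k F k_ball Fk in \<open>auto simp: \<Omega>_def intro: holomorphic_on_imp_continuous_on\<close>)
  from homeomorphism_compose[OF this p]
  have "homeomorphism \<Omega> upper_half_plane (f \<circ> k) (F \<circ> p)" .
  \<comment> \<open>As \<open>Im f = Im F\<close>, in the coordinate \<open>w = F z\<close> the map
    \<open>f\<close> keeps the imaginary part, and its real part is that of a holomorphic
    function.\<close>
  moreover have "Complex (Re (h (k w) + g (k w))) (Im w) = (f \<circ> k) w" if "w \<in> \<Omega>" for w
    using arg_cong[OF Fk[OF that], of Im] by (simp add: f_def F_def complex_eq_iff)
  ultimately have "homeomorphism \<Omega> upper_half_plane (\<lambda>w. Complex (Re (h (k w) + g (k w))) (Im w)) (F \<circ> p)"
    by (rule homeomorphism_cong[OF _ refl refl]) auto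
  moreover have "(\<lambda>w. h (k w) + g (k w)) holomorphic_on \<Omega>"
    by (intro holomorphic_intros holomorphic_on_compose_gen[OF k(1) h, unfolded o_def]
        holomorphic_on_compose_gen[OF k(1) g, unfolded o_def]) (use k_ball in auto)
  ultimately have "F ` ball 0 1 = upper_half_plane"
    using horizontal_shear_onto[OF \<open>open \<Omega>\<close>] unfolding \<Omega>_def by blast
  then have "Im (F 0) / 2 \<le> norm (deriv F z)"
    by (rule deriv_bound_disc_onto_half_plane[OF F inj _ z])
  moreover have "Im (F 0) = 1" using arg_cong[OF f0, of Im] by (simp add: F_def)
  moreover have "deriv F z = deriv h z - deriv g z"
    unfolding F_def
    by (rule deriv_diff) (use h g z in \<open>auto intro: holomorphic_on_imp_differentiable_at\<close>)
  ultimately show ?thesis using norm_triangle_ineq4[of "deriv h z" "deriv g z"] by simp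
qed

text \<open>The witness for sharpness: with second component 0 the harmonic map is conformal, here
  the Cayley transform, whose derivative has norm \<open>2 / (norm (1 - z))\<^sup>2\<close>.\<close>

lemma admissible_pair_Cayley: "admissible_pair (\<lambda>z. \<i> * (1 + z) / (1 - z)) (\<lambda>_. 0)"
proof -
  define f where "f = (\<lambda>z::complex. \<i> * (1 + z) / (1 - z))"
  define p where "p = (\<lambda>w. (w - \<i>) / (w + \<i>))"
  have f: "f holomorphic_on ball 0 1" unfolding f_def by (intro holomorphic_intros) auto
  have U_nz: "w + \<i> \<noteq> 0" if "w \<in> upper_half_plane" for w
    using that by (auto simp: upper_half_plane_def complex_eq_iff)
  have p: "p holomorphic_on upper_half_plane"
    unfolding p_def using U_nz by (intro holomorphic_intros) auto
  have "homeomorphism (ball 0 1) upper_half_plane f p"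
  proof (rule homeomorphismI)
    show "f ` ball 0 1 \<subseteq> upper_half_plane"
    proof safe
      fix z :: complex assume "z \<in> ball 0 1"
      then have z: "norm z < 1" "z \<noteq> 1" by auto
      then have "Re z * Re z + Im z * Im z < 1"
        by (metis cmod_power2 norm_ge_zero one_power2 power2_eq_square power_strict_mono zero_less_numeral)
      moreover have "Im (\<i> * (1 + z) * cnj (1 - z)) = 1 - (Re z * Re z + Im z * Im z)"
        by (simp add: algebra_simps)
      ultimately show "f z \<in> upper_half_plane"
        using z by (simp add: upper_half_plane_def f_def Im_complex_div_gt_0)
    qed
    show "p ` upper_half_plane \<subseteq> ball 0 1"
    proof safe
      fix w assume w: "w \<in> upper_half_plane"
      then have "(norm (w - \<i>))\<^sup>2 < (norm (w + \<i>))\<^sup>2"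
        by (simp add: cmod_power2 upper_half_plane_def) (simp add: power2_eq_square algebra_simps)
      then have "norm (w - \<i>) < norm (w + \<i>)" by (simp add: power2_less_imp_less)
      then show "p w \<in> ball 0 1" using U_nz[OF w] by (simp add: p_def norm_divide)
    qed
    show "p (f z) = z" if "z \<in> ball 0 1" for z
    proof -
      have "1 - z \<noteq> 0" using that by auto
      then have "f z - \<i> = 2 * \<i> * z / (1 - z)" "f z + \<i> = 2 * \<i> / (1 - z)"
        by (simp_all add: f_def field_simps)
      then show ?thesis using \<open>1 - z \<noteq> 0\<close> by (simp add: p_def)
    qed
    show "f (p w) = w" if "w \<in> upper_half_plane" for w
      using U_nz[OF that] by (simp add: p_def f_def divide_simps)
  qed (use f p in \<open>auto intro: holomorphic_on_imp_continuous_on\<close>)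
  moreover have "\<phi> differentiable_on S" if "\<phi> holomorphic_on S" for \<phi> :: "complex \<Rightarrow> complex" and S
    using that unfolding holomorphic_on_def differentiable_on_def
    by (meson field_differentiable_imp_differentiable)
  ultimately show ?thesis
    using f p by (auto simp: admissible_pair_def diffeo_between_def f_def[symmetric]) (simp add: f_def)
qed

theorem theorem1p2:
  shows "(\<forall>h g. admissible_pair h g \<longrightarrow>
            (\<forall>z\<in>ball 0 1. norm (deriv h z) + norm (deriv g z)
                \<ge> infdist (h 0 + cnj (g 0)) (frontier upper_half_plane) / 2))
       \<and> (\<forall>c > 1/2. \<exists>h g z. admissible_pair h g \<and> z \<in> ball 0 1 \<and>
            norm (deriv h z) + norm (deriv g z)
              < c * infdist (h 0 + cnj (g 0)) (frontier upper_half_plane))"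
proof (intro conjI allI impI ballI)
  fix h g z assume hg: "admissible_pair h g" and z: "z \<in> ball (0::complex) 1"
  have "h 0 + cnj (g 0) = \<i>" using hg by (simp add: admissible_pair_def)
  then show "infdist (h 0 + cnj (g 0)) (frontier upper_half_plane) / 2
      \<le> norm (deriv h z) + norm (deriv g z)"
    using admissible_pair_lower_bound[OF hg z] by (simp add: infdist_frontier_upper_half_plane)
next
  fix c :: real assume c: "1 / 2 < c"
  \<comment> \<open>At \<open>z = - t\<close> the derivative of the Cayley transform has norm
    \<open>2 / (1 + t)\<^sup>2\<close>. The value 1/2 is approached as \<open>z\<close> tends to the
    boundary point -1.\<close>
  have "((\<lambda>t. 2 / (1 + t)\<^sup>2) \<longlongrightarrow> 2 / (1 + 1)\<^sup>2) (at_left (1::real))"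
    by (intro tendsto_intros) auto
  then have "\<forall>\<^sub>F t in at_left (1::real). 2 / (1 + t)\<^sup>2 < c"
    by (rule order_tendstoD) (use c in simp)
  moreover have "\<forall>\<^sub>F t in at_left (1::real). t \<in> {0<..<1}"
    by (rule eventually_at_left_real) simp
  ultimately obtain t :: real where t: "2 / (1 + t)\<^sup>2 < c" "0 < t" "t < 1"
    using eventually_happens'[OF trivial_limit_at_left_real eventually_conj] by force
  define h where "h = (\<lambda>z::complex. \<i> * (1 + z) / (1 - z))"
  define z :: complex where "z = - of_real t"
  have nz: "1 - z \<noteq> 0" using t by (auto simp: z_def complex_eq_iff)
  have "(h has_field_derivative 2 * \<i> / (1 - z)\<^sup>2) (at z)"
    unfolding h_def using nz
    by (auto intro!: derivative_eq_intros simp: divide_simps power2_eq_square) (auto simp: algebra_simps)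
  then have "deriv h z = 2 * \<i> / (1 - z)\<^sup>2" by (rule DERIV_imp_deriv)
  moreover have "norm (1 - z) = 1 + t"
    using t norm_of_real[of "1 + t", where 'a = complex] by (simp add: z_def)
  ultimately have "norm (deriv h z) = 2 / (1 + t)\<^sup>2"
    by (simp add: norm_divide norm_mult norm_power)
  moreover have "admissible_pair h (\<lambda>_. 0)"
    unfolding h_def by (rule admissible_pair_Cayley)
  moreover have "h 0 = \<i>" by (simp add: h_def)
  ultimately show "\<exists>h g z. admissible_pair h g \<and> z \<in> ball 0 1 \<and>
            norm (deriv h z) + norm (deriv g z)
              < c * infdist (h 0 + cnj (g 0)) (frontier upper_half_plane)"
    using t by (intro exI[of _ h] exI[of _ "\<lambda>_. 0"] exI[of _ z])
      (simp add: infdist_frontier_upper_half_plane z_def)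
qed

end
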